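(* Let $\lambda>-1/2$, $\lambda\neq1/2$, $z>0$, and let $(P_n)_{n\ge0}$ be the monic polynomials orthogonal with respect to the weight $(1-x^2)^{\lambda-1/2}e^{-zx^2}$ on $(-1,1)$, satisfying $xP_n(x)=P_{n+1}(x)+\gamma_nP_{n-1}(x)$. For each integer $n\ge0$ let $L_n$ be the operator $$L_n=A_n(x;z)\,\partial_x-B_n(x;z),\qquad A_n(x;z)=\frac{\phi(x)}{C_n(x;z;\lambda)},\quad B_n(x;z)=\frac{\delta_n(x;z)}{C_n(x;z;\lambda)},$$ where $\phi(x)=1-x^2$, $$C_n(x;z;\lambda)=2\gamma_{n+1}\left[n+1+\lambda+z-z(\gamma_{n+2}+\gamma_{n+1})-zx^2\right],\qquad \delta_n(x;z)=(2z\gamma_{n+1}-n-1)\,x.$$ Then $L_nP_{n+1}=P_n$ for all $n\ge0$.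
   Context: The monic orthogonal polynomials satisfy $\deg P_n=n$ and $\int_{-1}^1P_nP_m(1-x^2)^{\lambda-1/2}e^{-zx^2}dx=0$ for $n\ne m$; since the weight is even, the recurrence has the stated form for $n\ge0$ with $P_{-1}=0$, $P_0=1$. The identity is an identity of rational functions of $x$. *)

theory Defs
  imports
    "HOL-Analysis.Analysis"
    "HOL-Computational_Algebra.Computational_Algebra"
begin

definition weight :: "real \<Rightarrow> real \<Rightarrow> real \<Rightarrow> real" where
  "weight lam z x = (1 - x\<^sup>2) powr (lam - 1/2) * exp (- z * x\<^sup>2)"

definition monic_orthogonal :: "(real \<Rightarrow> real) \<Rightarrow> (nat \<Rightarrow> real poly) \<Rightarrow> bool" where
  "monic_orthogonal w P \<longleftrightarrow>
     (\<forall>n. degree (P n) = n \<and> lead_coeff (P n) = 1) \<and>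
     (\<forall>n m. n \<noteq> m \<longrightarrow> (LBINT x:{-1<..<1}. poly (P n) x * poly (P m) x * w x) = 0)"

definition phi :: "real poly" where
  "phi = [:1, 0, -1:]"

definition C :: "real \<Rightarrow> real \<Rightarrow> (nat \<Rightarrow> real) \<Rightarrow> nat \<Rightarrow> real poly" where
  "C lam z \<gamma> n =
     smult (2 * \<gamma> (n + 1))
       ([: real n + 1 + lam + z - z * (\<gamma> (n + 2) + \<gamma> (n + 1)) :] - smult z (monom 1 2))"

definition delta :: "real \<Rightarrow> (nat \<Rightarrow> real) \<Rightarrow> nat \<Rightarrow> real poly" where
  "delta z \<gamma> n = monom (2 * z * \<gamma> (n + 1) - real n - 1) 1"

text \<open>
  Rational functions in \<open>x\<close> are elements of the fraction field \<open>real poly fract\<close>;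
  \<open>to_fract\<close> embeds the polynomials.  Division by zero is zero there, so \<open>A\<close> and
  \<open>B\<close> vanish if \<open>C lam z \<gamma> n = 0\<close>.
\<close>

definition A :: "real \<Rightarrow> real \<Rightarrow> (nat \<Rightarrow> real) \<Rightarrow> nat \<Rightarrow> real poly fract" where
  "A lam z \<gamma> n = to_fract phi / to_fract (C lam z \<gamma> n)"

definition B :: "real \<Rightarrow> real \<Rightarrow> (nat \<Rightarrow> real) \<Rightarrow> nat \<Rightarrow> real poly fract" where
  "B lam z \<gamma> n = to_fract (delta z \<gamma> n) / to_fract (C lam z \<gamma> n)"

definition L :: "real \<Rightarrow> real \<Rightarrow> (nat \<Rightarrow> real) \<Rightarrow> nat \<Rightarrow> real poly \<Rightarrow> real poly fract" where
  "L lam z \<gamma> n p =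
     A lam z \<gamma> n * to_fract (pderiv p) - B lam z \<gamma> n * to_fract p"

end

theory Submission
  imports Defs
begin

text \<open>
  The weight satisfies a Pearson equation \<open>(\<phi> w)' = \<psi> w\<close> with \<open>\<psi>\<close> an odd cubic, and
  \<open>\<phi> w\<close> vanishes at \<open>\<plusminus>1\<close>.  Integrating by parts, \<open>\<phi> P\<^sub>n\<^sub>+\<^sub>1'\<close> is therefore orthogonal to
  all \<open>P\<^sub>k\<close> except \<open>k = n + 2, n, n - 2\<close>, and its coefficients there follow from the
  three-term recurrence.  The claimed identity is the result of expanding \<open>x P\<^sub>n\<^sub>+\<^sub>1\<close> and
  \<open>x\<^sup>2 P\<^sub>n\<close> in the same basis.  Since \<open>\<gamma>\<^sub>n\<^sub>+\<^sub>1 = \<parallel>P\<^sub>n\<^sub>+\<^sub>1\<parallel>\<^sup>2 / \<parallel>P\<^sub>n\<parallel>\<^sup>2 \<noteq> 0\<close>, the polynomial \<open>C\<^sub>n\<close>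
  is not zero.
\<close>

section \<open>Integrability against the weight and definiteness of its moment functional\<close>

text \<open>With t = (x + 1)/2 one has 1 - x^2 = 4 t (1 - t), so up to a constant factor this is a
  Beta integral; nonnegativity turns gauge integrability into absolute integrability.\<close>

lemma set_integrable_one_minus_square_powr:
  assumes "e > (-1 :: real)"
  shows "set_integrable lborel {-1<..<1::real} (\<lambda>x. (1 - x\<^sup>2) powr e)"
proof -
  define f where "f t = t powr e * (1 - t) powr e" for t :: real
  have "(f has_integral Beta (e + 1) (e + 1)) (cbox 0 1)"
    using has_integral_Beta_real[of "e + 1" "e + 1"] assms by (simp add: f_def [abs_def])
  from has_integral_affinity'[OF this, of "1/2" "1/2"]
  have "(\<lambda>x. f (x / 2 + 1 / 2)) integrable_on box (-1) 1"
    by (subst integrable_on_open_interval) (auto simp: integrable_on_def)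
  then have "(\<lambda>x. 4 powr e * f (x / 2 + 1 / 2)) integrable_on {-1<..<1}"
    by simp
  moreover have scale: "4 powr e * f s = (4 * s * (1 - s)) powr e" if "0 \<le> s" "s \<le> 1" for s
    using that by (simp add: f_def powr_mult)
  moreover have "4 powr e * f (x / 2 + 1 / 2) = (1 - x\<^sup>2) powr e" if "x \<in> {-1<..<1}" for x
  proof -
    have "4 powr e * f (x / 2 + 1 / 2) = (4 * (x / 2 + 1 / 2) * (1 - (x / 2 + 1 / 2))) powr e"
      using that by (intro scale) auto
    also have "4 * (x / 2 + 1 / 2) * (1 - (x / 2 + 1 / 2)) = 1 - x\<^sup>2"
      by (simp add: field_simps power2_eq_square)
    finally show ?thesis .
  qed
  ultimately have "(\<lambda>x. (1 - x\<^sup>2) powr e) integrable_on {-1<..<1}"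
    by (subst (asm) integrable_cong) auto
  then have "(\<lambda>x. (1 - x\<^sup>2) powr e) absolutely_integrable_on {-1<..<1}"
    by (rule nonnegative_absolutely_integrable_1) simp
  then show ?thesis
    unfolding set_integrable_def by (subst (asm) integrable_completion) simp_all
qed

text \<open>Viewing the integral as a functional on polynomials lets the later algebra use only
  linearity, definiteness and the Pearson identity.\<close>

definition moment :: "real \<Rightarrow> real \<Rightarrow> real poly \<Rightarrow> real" where
  "moment lam z p = (LBINT x:{-1<..<1}. poly p x * weight lam z x)"

lemma weight_nonneg: "weight lam z x \<ge> 0"
  by (simp add: weight_def)

lemma weight_pos:
  assumes "x \<in> {-1<..<1}"
  shows "weight lam z x > 0"
proof -
  have "x\<^sup>2 < 1" using assms by (simp add: abs_square_less_1 abs_less_iff)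
  then show ?thesis by (simp add: weight_def)
qed

lemma borel_measurable_poly [measurable]: "poly p \<in> borel_measurable (borel :: real measure)"
  by (intro borel_measurable_continuous_onI continuous_intros)

lemma weight_measurable [measurable]: "weight lam z \<in> borel_measurable borel"
  unfolding weight_def [abs_def] by measurable

text \<open>On the compact interval [-1, 1] the factor p(x) exp(-z x^2) is bounded, so a multiple of
  the singular factor dominates the integrand.\<close>

lemma set_integrable_poly_weight:
  assumes "lam > - 1/2"
  shows "set_integrable lborel {-1<..<1} (\<lambda>x. poly p x * weight lam z x)"
proof -
  have "compact ((\<lambda>x. poly p x * exp (- z * x\<^sup>2)) ` {-1..1})"
    by (intro compact_continuous_image continuous_intros) auto
  then obtain K where K: "\<And>x. x \<in> {-1..1} \<Longrightarrow> \<bar>poly p x * exp (- z * x\<^sup>2)\<bar> \<le> K"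
    by (force dest!: compact_imp_bounded simp: bounded_iff)
  have "set_integrable lborel {-1<..<1} (\<lambda>x. K * (1 - x\<^sup>2) powr (lam - 1/2))"
    using set_integrable_one_minus_square_powr[of "lam - 1/2"] assms by (intro set_integrable_mult_right) simp
  then show ?thesis
  proof (rule set_integrable_bound)
    show "set_borel_measurable lborel {-1<..<1} (\<lambda>x. poly p x * weight lam z x)"
      unfolding set_borel_measurable_def by measurable
    show "AE x in lborel. x \<in> {-1<..<1} \<longrightarrow>
        norm (poly p x * weight lam z x) \<le> norm (K * (1 - x\<^sup>2) powr (lam - 1/2))"
    proof (intro AE_I2 impI)
      fix x :: real assume "x \<in> {-1<..<1}"
      then have "\<bar>poly p x * exp (- z * x\<^sup>2)\<bar> \<le> \<bar>K\<bar>"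
        using K[of x] by fastforce
      then have "\<bar>poly p x * exp (- z * x\<^sup>2)\<bar> * (1 - x\<^sup>2) powr (lam - 1/2)
          \<le> \<bar>K\<bar> * (1 - x\<^sup>2) powr (lam - 1/2)"
        by (rule mult_right_mono) simp
      then show "norm (poly p x * weight lam z x) \<le> norm (K * (1 - x\<^sup>2) powr (lam - 1/2))"
        by (simp add: weight_def abs_mult mult_ac)
    qed
  qed
qed

lemma moment_add:
  assumes "lam > - 1/2"
  shows "moment lam z (p + q) = moment lam z p + moment lam z q"
  unfolding moment_def
  using set_integral_add(2)[OF set_integrable_poly_weight[OF assms, of p z]
      set_integrable_poly_weight[OF assms, of q z]]
  by (simp add: distrib_right)

lemma moment_smult: "moment lam z (smult c p) = c * moment lam z p"
  by (simp add: moment_def mult.assoc)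

text \<open>The integrand p^2 w is nonnegative, hence zero almost everywhere; for nonzero p it is
  positive on (-1, 1) off finitely many roots, which would make the interval a null set.\<close>

lemma moment_square_eq_0_imp:
  assumes "lam > - 1/2" and "moment lam z (p * p) = 0"
  shows "p = 0"
proof (rule ccontr)
  assume "p \<noteq> 0"
  let ?f = "\<lambda>x. indicator {-1<..<1} x *\<^sub>R (poly (p * p) x * weight lam z x)"
  have "AE x in lborel. ?f x = 0"
  proof (subst integral_nonneg_eq_0_iff_AE[symmetric])
    show "integrable lborel ?f"
      using set_integrable_poly_weight[OF assms(1)] unfolding set_integrable_def .
    show "integral\<^sup>L lborel ?f = 0"
      using assms(2) unfolding moment_def set_lebesgue_integral_def .
  qed (simp add: weight_nonneg)
  moreover have "AE x in lborel. x \<notin> {x. poly p x = 0}"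
    by (intro AE_not_in finite_imp_null_set_lborel poly_roots_finite \<open>p \<noteq> 0\<close>)
  ultimately have "AE x in lborel. x \<notin> {-1<..<1::real}"
  proof eventually_elim
    case (elim x)
    then show ?case using weight_pos[of x lam z] by auto
  qed
  then have "emeasure lborel {-1<..<1::real} = 0"
    by (subst (asm) AE_iff_measurable[where N = "{-1<..<1}"]) auto
  then show False by simp
qed

section \<open>Pearson equation of the weight\<close>

lemma moment_Pearson:
  assumes "lam > - 1/2"
  shows "moment lam z (phi * pderiv p + [:0, - (2 * lam + 1 + 2 * z), 0, 2 * z:] * p) = 0"
    (is "moment lam z ?q = 0")
proof -
  define q where "q = ?q"
  \<comment> \<open>This is p \<phi> w with the two powers of 1 - x^2 merged. The exponent is
    positive, so \<open>F\<close> is continuous up to the endpoints and vanishes there, although w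
    may blow up.\<close>
  define F where "F x = poly p x * ((1 - x\<^sup>2) powr (lam + 1/2) * exp (- z * x\<^sup>2))" for x
  have "((\<lambda>x. poly q x * weight lam z x) has_integral F 1 - F (-1)) {-1..1}"
  proof (rule fundamental_theorem_of_calculus_interior)
    show "continuous_on {-1..1} F"
      unfolding F_def using assms
      by (intro continuous_intros continuous_on_powr') (auto simp: abs_square_le_1)
    fix x :: real assume x: "x \<in> {-1<..<1}"
    then have pos: "1 - x\<^sup>2 > 0"
      by (simp add: abs_square_less_1 abs_less_iff)
    then have powr_lam: "(1 - x\<^sup>2) powr (lam + 1/2) = (1 - x\<^sup>2) * (1 - x\<^sup>2) powr (lam - 1/2)"
      using powr_add[of "1 - x\<^sup>2" 1 "lam - 1/2"] by (simp add: add.commute)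
    have "((\<lambda>x. (1 - x\<^sup>2) powr (lam + 1/2)) has_real_derivative
        (lam + 1/2) * (1 - x\<^sup>2) powr (lam - 1/2) * (- (2 * x))) (at x)"
      using pos by (auto intro!: derivative_eq_intros)
    moreover have "((\<lambda>x. exp (- z * x\<^sup>2)) has_real_derivative
        exp (- z * x\<^sup>2) * (- z * (2 * x))) (at x)"
      by (auto intro!: derivative_eq_intros)
    ultimately have "(F has_real_derivative
        poly (pderiv p) x * ((1 - x\<^sup>2) powr (lam + 1/2) * exp (- z * x\<^sup>2)) +
        ((lam + 1/2) * (1 - x\<^sup>2) powr (lam - 1/2) * (- (2 * x)) * exp (- z * x\<^sup>2) +
         exp (- z * x\<^sup>2) * (- z * (2 * x)) * (1 - x\<^sup>2) powr (lam + 1/2)) * poly p x) (at x)"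
      unfolding F_def by (intro DERIV_mult poly_DERIV)
    also have "poly (pderiv p) x * ((1 - x\<^sup>2) powr (lam + 1/2) * exp (- z * x\<^sup>2)) +
        ((lam + 1/2) * (1 - x\<^sup>2) powr (lam - 1/2) * (- (2 * x)) * exp (- z * x\<^sup>2) +
         exp (- z * x\<^sup>2) * (- z * (2 * x)) * (1 - x\<^sup>2) powr (lam + 1/2)) * poly p x
        = poly q x * weight lam z x"
      unfolding powr_lam weight_def q_def
      by (simp add: phi_def) (simp add: algebra_simps power2_eq_square)
    finally have "(F has_real_derivative poly q x * weight lam z x) (at x)" .
    then show "(F has_vector_derivative poly q x * weight lam z x) (at x)"
      by (simp add: has_real_derivative_iff_has_vector_derivative)
  qed simp
  then have "((\<lambda>x. poly q x * weight lam z x) has_integral 0) {-1<..<1}"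
    by (simp add: F_def has_integral_Icc_iff_Ioo)
  then show ?thesis
    unfolding q_def[symmetric] moment_def
    using set_borel_integral_eq_integral(2)[OF set_integrable_poly_weight[OF assms, of q z]]
    by (simp add: integral_unique)
qed

text \<open>Serves to read off top coefficients: if p is monic of degree d, then \<phi> p' has
  degree at most d + 1, with coefficient -d at x^(d+1).\<close>

lemma coeff_phi_pderiv:
  assumes "i > 0"
  shows "coeff (phi * pderiv p) i = real (i + 1) * coeff p (i + 1) - (real i - 1) * coeff p (i - 1)"
proof -
  obtain j where j: "i = Suc j" using assms gr0_conv_Suc by blast
  have "phi * pderiv p = pderiv p - pCons 0 (pCons 0 (pderiv p))"
    by (simp add: phi_def)
  then show ?thesis
    by (cases j) (simp_all add: j coeff_pCons coeff_pderiv)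
qed

section \<open>Orthogonal polynomials of a definite functional\<close>

text \<open>Subtraction on indices is truncated, so at n = 0 the term \<open>P (n - 1)\<close> is
  \<open>P 0\<close>; the convention that P with index -1 is zero is carried by
  \<open>g 0 = 0\<close>.\<close>

locale orthogonal_recurrence =
  fixes M :: "real poly \<Rightarrow> real" and P :: "nat \<Rightarrow> real poly" and g :: "nat \<Rightarrow> real"
  assumes M_add: "M (p + q) = M p + M q"
    and M_smult: "M (smult c p) = c * M p"
    and M_square_eq_0_imp: "M (p * p) = 0 \<Longrightarrow> p = 0"
    and degree_P: "degree (P n) = n"
    and lead_coeff_P: "lead_coeff (P n) = 1"
    and orthogonal: "n \<noteq> m \<Longrightarrow> M (P n * P m) = 0"
    and recurrence: "[:0, 1:] * P n = P (n + 1) + smult (g n) (P (n - 1))"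
    and g_0: "g 0 = 0"
begin

lemma M_uminus: "M (- p) = - M p"
  using M_smult[of "-1" p] by simp

lemma M_diff: "M (p - q) = M p - M q"
  using M_add[of p "- q"] by (simp add: M_uminus)

lemmas M_linear = M_add M_smult M_uminus M_diff

lemma coeff_P: "coeff (P n) n = 1" "n < i \<Longrightarrow> coeff (P n) i = 0"
  using lead_coeff_P[of n] by (simp_all add: degree_P coeff_eq_0)

text \<open>Each \<open>P N\<close> is monic of degree \<open>N\<close>, so subtracting a multiple
  of it lowers the degree bound. \<open>T\<close> is kept general to cover pairing with a fixed
  \<open>P m\<close> and with the remainder in the structure relation.\<close>

lemma vanishes_on_lower_degree:
  assumes "\<And>p q. T (p + q) = T p + T q" "\<And>c p. T (smult c p) = c * T p"
    and "\<And>k. k < N \<Longrightarrow> T (P k) = 0" and "\<And>i. N \<le> i \<Longrightarrow> coeff q i = 0"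
  shows "T q = (0 :: real)"
  using assms(3,4)
proof (induction N arbitrary: q)
  case 0
  then have "q = smult 0 q" by (simp add: poly_eq_iff)
  then show ?case using assms(2)[of 0 q] by simp
next
  case (Suc N)
  define r where "r = q - smult (coeff q N) (P N)"
  have "coeff r i = 0" if "N \<le> i" for i
    using that Suc.prems(2)[of i] by (cases "i = N") (auto simp: r_def coeff_P)
  then have "T r = 0"
    using Suc by simp
  moreover have "q = r + smult (coeff q N) (P N)"
    by (simp add: r_def)
  ultimately show ?case
    by (metis Suc.prems(1) assms(1,2) lessI mult_zero_right add_0)
qed

lemma orthogonal_lower_degree:
  assumes "\<And>i. m \<le> i \<Longrightarrow> coeff q i = 0"
  shows "M (q * P m) = 0"
  by (rule vanishes_on_lower_degree[where T = "\<lambda>q. M (q * P m)" and N = m])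
     (use assms orthogonal in \<open>auto simp: M_linear distrib_right\<close>)

lemma norm_nonzero: "M (P n * P n) \<noteq> 0"
  using M_square_eq_0_imp[of "P n"] coeff_P(1)[of n] by auto

text \<open>The moment of x P_n P_(n+1) is computed twice, by letting x act on either
  factor.\<close>

lemma norm_Suc: "M (P (Suc n) * P (Suc n)) = g (Suc n) * M (P n * P n)"
proof -
  have "([:0, 1:] * P n) * P (Suc n) = ([:0, 1:] * P (Suc n)) * P n"
    by (simp only: ac_simps)
  then have "M ((P (n + 1) + smult (g n) (P (n - 1))) * P (Suc n))
      = M ((P (Suc n + 1) + smult (g (Suc n)) (P (Suc n - 1))) * P n)"
    by (simp only: recurrence)
  then show ?thesis
    by (simp add: M_linear distrib_right orthogonal)
qed

lemma g_Suc_nonzero: "g (Suc n) \<noteq> 0"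
  using norm_Suc[of n] norm_nonzero[of "Suc n"] by auto

text \<open>The truncated index \<open>n - 2\<close> is harmless: for n = 0 and n = 1 its
  coefficient contains the factor \<open>g 0\<close>.\<close>

lemma recurrence_square:
  "[:0, 1:] * ([:0, 1:] * P n) =
     P (n + 2) + smult (g n + g (n + 1)) (P n) + smult (g n * g (n - 1)) (P (n - 2))"
proof -
  have "smult (g n) ([:0, 1:] * P (n - 1)) = smult (g n) (P n) + smult (g n * g (n - 1)) (P (n - 2))"
    by (cases n) (simp_all only: recurrence, simp_all add: g_0 smult_add_right numeral_2_eq_2)
  then show ?thesis
    by (simp only: recurrence[of n] distrib_left mult_smult_right recurrence[of "n + 1"])
       (simp add: smult_add_left)
qed

lemma recurrence_cube:
  "[:0, 1:] * ([:0, 1:] * ([:0, 1:] * P n)) =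
     P (n + 3) + smult (g n + g (n + 1) + g (n + 2)) (P (n + 1))
     + smult (g n * (g (n - 1) + g n + g (n + 1))) (P (n - 1))
     + smult (g n * g (n - 1) * g (n - 2)) (P (n - 3))"
proof -
  have "smult (g n * g (n - 1)) ([:0, 1:] * P (n - 2))
      = smult (g n * g (n - 1)) (P (n - 1)) + smult (g n * g (n - 1) * g (n - 2)) (P (n - 3))"
  proof (cases "n \<le> 1")
    case True
    then have "n = 0 \<or> n = 1" by auto
    then show ?thesis by (auto simp: g_0)
  next
    case False
    then have "n - 2 + 1 = n - 1" "n - 2 - 1 = n - 3" by auto
    then show ?thesis by (simp only: recurrence) (simp add: smult_add_right)
  qed
  moreover have "[:0, 1:] * ([:0, 1:] * ([:0, 1:] * P n)) =
      [:0, 1:] * P (n + 2) + smult (g n + g (n + 1)) ([:0, 1:] * P n)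
      + smult (g n * g (n - 1)) ([:0, 1:] * P (n - 2))"
    by (simp only: recurrence_square distrib_left mult_smult_right)
  ultimately show ?thesis
    by (simp only: recurrence[of "n + 2"] recurrence[of n])
       (simp add: smult_add_left smult_add_right algebra_simps numeral_3_eq_3)
qed

end

section \<open>Structure relation and lowering operator\<close>

locale Pearson_orthogonal_recurrence = orthogonal_recurrence +
  fixes c z :: real
  assumes Pearson: "M (phi * pderiv q + [:0, - c, 0, 2 * z:] * q) = 0"
begin

text \<open>Integration by parts: the Pearson identity applied to the product of \<open>p\<close>
  and \<open>q\<close>.\<close>

lemma M_phi_pderiv_swap:
  "M (phi * pderiv p * q) = - M (phi * pderiv q * p) - M ([:0, - c, 0, 2 * z:] * p * q)"
proof -
  have "phi * pderiv (p * q) + [:0, - c, 0, 2 * z:] * (p * q)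
      = phi * pderiv p * q + phi * pderiv q * p + [:0, - c, 0, 2 * z:] * p * q"
    by (simp only: pderiv_mult algebra_simps)
  then show ?thesis
    using Pearson[of "p * q"] by (simp only: M_linear)
qed

text \<open>Adding k P_(k+1) cancels the top term of \<phi> P_k', leaving degree at most k, which is
  orthogonal to \<open>P m\<close>.\<close>

lemma M_phi_pderiv_P:
  assumes "k < m"
  shows "M (phi * pderiv (P k) * P m) = (if Suc k = m then - real k * M (P m * P m) else 0)"
proof -
  define q where "q = phi * pderiv (P k) + smult (real k) (P (Suc k))"
  have "coeff q i = 0" if "m \<le> i" for i
    using that assms by (cases "i = Suc k") (auto simp: q_def coeff_phi_pderiv coeff_P)
  then have "M (q * P m) = 0"
    by (rule orthogonal_lower_degree)
  then show ?thesis
    by (auto simp: q_def distrib_right M_linear orthogonal)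
qed

text \<open>The cubic is 2 z x^3 - c x. As k \<le> m, only the components of index k + 1 and k + 3
  in its product with P_k can meet \<open>P m\<close>.\<close>

lemma M_Pearson_P:
  assumes "k \<le> m"
  shows "M ([:0, - c, 0, 2 * z:] * P k * P m) =
    ((if k + 3 = m then 2 * z else 0)
     + (if k + 1 = m then 2 * z * (g k + g (k + 1) + g (k + 2)) - c else 0)) * M (P m * P m)"
proof -
  have "[:0, - c, 0, 2 * z:] * P k =
      smult (2 * z) ([:0, 1:] * ([:0, 1:] * ([:0, 1:] * P k))) - smult c ([:0, 1:] * P k)"
    by (rule poly_eq_poly_eq_iff[THEN iffD1]) (simp add: fun_eq_iff algebra_simps)
  then have "M ([:0, - c, 0, 2 * z:] * P k * P m) =
      2 * z * M ([:0, 1:] * ([:0, 1:] * ([:0, 1:] * P k)) * P m) - c * M ([:0, 1:] * P k * P m)"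
    by (simp only: left_diff_distrib mult_smult_left M_linear)
  also have "M ([:0, 1:] * P k * P m) = (if k + 1 = m then M (P m * P m) else 0)"
    using assms by (cases k) (auto simp only: recurrence, auto simp: distrib_right M_linear orthogonal g_0)
  also have "M ([:0, 1:] * ([:0, 1:] * ([:0, 1:] * P k)) * P m) =
      ((if k + 3 = m then 1 else 0) + (if k + 1 = m then g k + g (k + 1) + g (k + 2) else 0)) * M (P m * P m)"
    using assms unfolding recurrence_cube
    by (cases k) (auto simp: distrib_right M_linear orthogonal g_0)
  also have "2 * z * (((if k + 3 = m then 1 else 0)
        + (if k + 1 = m then g k + g (k + 1) + g (k + 2) else 0)) * M (P m * P m))
      - c * (if k + 1 = m then M (P m * P m) else 0) =
      ((if k + 3 = m then 2 * z else 0)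
        + (if k + 1 = m then 2 * z * (g k + g (k + 1) + g (k + 2)) - c else 0)) * M (P m * P m)"
    by (simp add: algebra_simps)
  finally show ?thesis .
qed

text \<open>The difference \<open>E\<close> of the two sides has degree below n + 2 and is
  orthogonal to every \<open>P k\<close> with k < n + 2, hence to itself, so definiteness makes it
  zero.\<close>

lemma structure_relation:
  "phi * pderiv (P (Suc n)) =
     smult (- real (Suc n)) (P (n + 2))
     + smult (g (n + 1) * (real n + c - 2 * z * (g n + g (n + 1) + g (n + 2)))) (P n)
     + smult (- 2 * z * g (n + 1) * g n * g (n - 1)) (P (n - 2))"
  (is "_ = smult _ _ + smult ?b _ + smult ?d _")
proof -
  define E where "E = phi * pderiv (P (Suc n)) + smult (real (Suc n)) (P (n + 2))
    - smult ?b (P n) - smult ?d (P (n - 2))"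
  have M_E: "M (E * q) = M (phi * pderiv (P (Suc n)) * q) + real (Suc n) * M (P (n + 2) * q)
      - ?b * M (P n * q) - ?d * M (P (n - 2) * q)" for q
    by (simp only: E_def distrib_right left_diff_distrib mult_smult_left M_linear)
  have coeff_E: "coeff E i = 0" if "n + 2 \<le> i" for i
    using that by (cases "i = n + 2") (auto simp: E_def coeff_phi_pderiv coeff_P)
  have M_E_P: "M (E * P k) = 0" if "k < n + 2" for k
  proof (cases "k = Suc n")
    case True
    \<comment> \<open>With equal arguments the swap says that this moment is its own negative, since
      the cubic contributes nothing on the diagonal.\<close>
    have "M (phi * pderiv (P (Suc n)) * P (Suc n)) = 0"
      using M_phi_pderiv_swap[of "P (Suc n)" "P (Suc n)"] M_Pearson_P[of "Suc n" "Suc n"] by simp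
    then show ?thesis
      using True by (simp add: M_E orthogonal)
  next
    case False
    with that have k: "k < Suc n" by simp
    \<comment> \<open>The derivative is moved onto \<open>P k\<close>, whose lower degree makes both
      resulting moments explicit multiples of the squared norm of \<open>P (Suc n)\<close>.\<close>
    have "M (phi * pderiv (P (Suc n)) * P k) =
        (if k = n then real n * M (P (Suc n) * P (Suc n)) else 0)
        - M ([:0, - c, 0, 2 * z:] * P k * P (Suc n))"
      using M_phi_pderiv_swap[of "P k" "P (Suc n)"] M_phi_pderiv_P[OF k] by auto
    moreover have "M (P (n + 2) * P k) = 0"
      using k by (simp add: orthogonal)
    ultimately have *: "M (phi * pderiv (P (Suc n)) * P k) =
        (if k = n then real n * M (P (Suc n) * P (Suc n)) else 0)
        - ((if k + 3 = Suc n then 2 * z else 0)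
          + (if k + 1 = Suc n then 2 * z * (g k + g (k + 1) + g (k + 2)) - c else 0)) * M (P (Suc n) * P (Suc n))"
      "M (P (n + 2) * P k) = 0"
      using M_Pearson_P[of k "Suc n"] k by simp_all
    \<comment> \<open>The first two cases give the two lower coefficients; \<open>norm_Suc\<close>,
      used once or three times, converts the norm of \<open>P (Suc n)\<close> into that of
      \<open>P k\<close>.\<close>
    consider "k = n" | "k \<noteq> n" "n = k + 2" | "k \<noteq> n" "n \<noteq> k + 2"
      by blast
    then show ?thesis
    proof cases
      case 1
      then have "?d * M (P (n - 2) * P k) = 0"
        by (cases n) (auto simp: g_0 orthogonal)
      with 1 * show ?thesis
        by (simp add: M_E norm_Suc algebra_simps)
    next
      case 2
      with * show ?thesis
        by (simp add: M_E orthogonal norm_Suc algebra_simps)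
    next
      case 3
      \<comment> \<open>By truncation \<open>n - 2\<close> can equal \<open>k\<close> here only when
        n = 1 and k = 0, where \<open>g (n - 1)\<close> is zero.\<close>
      have "?d * M (P (n - 2) * P k) = 0"
      proof (cases "n \<le> 1")
        case True
        then have "n = 0 \<or> n = 1" by auto
        then show ?thesis by (auto simp: g_0)
      next
        case False
        with 3 show ?thesis by (auto simp: orthogonal)
      qed
      with 3 * show ?thesis
        by (simp add: M_E orthogonal)
    qed
  qed
  have "M (E * E) = 0"
    by (rule vanishes_on_lower_degree[where T = "\<lambda>q. M (E * q)" and N = "n + 2"])
       (simp_all add: distrib_left M_linear coeff_E M_E_P)
  then have "E = 0"
    by (rule M_square_eq_0_imp)
  moreover have "x = - a + b + d" if "x + a - b - d = 0" for x a b d :: "real poly"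
    using that by (simp add: algebra_simps)
  ultimately show ?thesis
    unfolding E_def smult_minus_left by blast
qed

text \<open>Expanding x P_(n+1) and x^2 P_n in P_(n+2), P_n, P_(n-2) reproduces the coefficients of
  the structure relation.\<close>

lemma lowering:
  assumes "c = 2 * lam + 1 + 2 * z"
  shows "phi * pderiv (P (n + 1)) = delta z g n * P (n + 1) + C lam z g n * P n"
proof (rule poly_eq_poly_eq_iff[THEN iffD1], rule ext)
  fix x
  have "poly (phi * pderiv (P (Suc n))) x = 
     - real (Suc n) * poly (P (n + 2)) x
     + g (n + 1) * (real n + c - 2 * z * (g n + g (n + 1) + g (n + 2))) * poly (P n) x
     + - 2 * z * g (n + 1) * g n * g (n - 1) * poly (P (n - 2)) x"
    by (simp only: structure_relation poly_add poly_smult)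
  moreover have "x * poly (P (n + 1)) x = poly (P (n + 2)) x + g (n + 1) * poly (P n) x"
    using arg_cong[OF recurrence[of "n + 1"], of "\<lambda>p. poly p x"] by simp
  moreover have "x * (x * poly (P n) x) = poly (P (n + 2)) x + (g n + g (n + 1)) * poly (P n) x
      + g n * g (n - 1) * poly (P (n - 2)) x"
    using arg_cong[OF recurrence_square[of n], of "\<lambda>p. poly p x"] by simp
  moreover have "poly (delta z g n * P (n + 1) + C lam z g n * P n) x =
      (2 * z * g (n + 1) - real n - 1) * (x * poly (P (n + 1)) x)
      + 2 * g (n + 1) * ((real n + 1 + lam + z - z * (g (n + 2) + g (n + 1))) * poly (P n) x
          - z * (x * (x * poly (P n) x)))"
    by (simp add: delta_def C_def poly_monom algebra_simps power2_eq_square)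
  ultimately show "poly (phi * pderiv (P (n + 1))) x =
      poly (delta z g n * P (n + 1) + C lam z g n * P n) x"
    by (simp add: assms algebra_simps)
qed

text \<open>Guards the division in the fraction field, where a zero denominator would make
  \<open>L\<close> the zero operator.\<close>

lemma C_nonzero:
  assumes "z \<noteq> 0"
  shows "C lam z g n \<noteq> 0"
proof -
  have "coeff (C lam z g n) 2 = - 2 * g (Suc n) * z"
    by (simp add: C_def numeral_2_eq_2)
  then show ?thesis
    using assms g_Suc_nonzero[of n] by auto
qed

end

theorem proposition5p2:
  fixes lam z :: real and P :: "nat \<Rightarrow> real poly" and \<gamma> :: "nat \<Rightarrow> real"
  assumes "lam > - 1/2" and "lam \<noteq> 1/2" and "z > 0"
    and "monic_orthogonal (weight lam z) P"
    and "\<And>n. [:0, 1:] * P n =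
                P (n + 1) + smult (\<gamma> n) (if n = 0 then 0 else P (n - 1))"
  shows "\<forall>n. L lam z \<gamma> n (P (n + 1)) = to_fract (P n)"
proof
  fix n
  \<comment> \<open>The recurrence leaves \<open>\<gamma> 0\<close> arbitrary, while the locale
    wants it to be 0. \<open>C\<close> and \<open>delta\<close> only involve indices at least 1, so
    the change does not affect them.\<close>
  define g where "g k = (if k = 0 then 0 else \<gamma> k)" for k
  interpret Pearson_orthogonal_recurrence "moment lam z" P g "2 * lam + 1 + 2 * z" z
  proof
    show "[:0, 1:] * P k = P (k + 1) + smult (g k) (P (k - 1))" for k
      using assms(5)[of k] by (auto simp: g_def)
    show "moment lam z (P k * P m) = 0" if "k \<noteq> m" for k m
      using assms(4) that by (simp add: monic_orthogonal_def moment_def)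
    show "degree (P k) = k" "lead_coeff (P k) = 1" for k
      using assms(4) unfolding monic_orthogonal_def by blast+
    show "moment lam z (phi * pderiv q + [:0, - (2 * lam + 1 + 2 * z), 0, 2 * z:] * q) = 0" for q
      using assms(1) by (rule moment_Pearson)
    show "p = 0" if "moment lam z (p * p) = 0" for p
      using assms(1) that by (rule moment_square_eq_0_imp)
  qed (use assms(1) in \<open>simp_all add: moment_add moment_smult g_def\<close>)
  have "C lam z g n = C lam z \<gamma> n" "delta z g n = delta z \<gamma> n"
    by (simp_all add: C_def delta_def g_def)
  then have "phi * pderiv (P (n + 1)) = delta z \<gamma> n * P (n + 1) + C lam z \<gamma> n * P n"
    and nonzero: "to_fract (C lam z \<gamma> n) \<noteq> 0"
    using lowering[of lam n] C_nonzero[of lam n] \<open>z > 0\<close> by simp_all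
  then have "to_fract phi * to_fract (pderiv (P (n + 1))) =
      to_fract (delta z \<gamma> n) * to_fract (P (n + 1)) + to_fract (C lam z \<gamma> n) * to_fract (P n)"
    by (metis to_fract_add to_fract_mult)
  then show "L lam z \<gamma> n (P (n + 1)) = to_fract (P n)"
    using nonzero by (simp add: L_def A_def B_def divide_simps)
qed

end
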